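(* Let $P$ be a partially ordered set with a least element $0$ and a greatest element $1$. Then there is a bounded lattice $K$ such that $P$ is isomorphic, as a partially ordered set, to $\mathrm{Princ}\, K$, the set of principal congruences of $K$ ordered by inclusion. Moreover, if $P$ is finite, then $K$ can be chosen to be a finite lattice.
   Context: A bounded lattice is a lattice with a least and a greatest element. A congruence of a lattice $K$ is an equivalence relation on $K$ compatible with both $\vee$ and $\wedge$; the congruences of $K$, ordered by inclusion, form the congruence lattice $\mathrm{Con}\, K$. For $a, b \in K$, the principal congruence $\mathrm{con}(a,b)$ is the smallest congruence of $K$ that identifies $a$ and $b$. $\mathrm{Princ}\, K = \{\mathrm{con}(a,b) : a, b \in K\}$ denotes the set of all principal congruences of $K$, regarded as a partially ordered set under the ordering (inclusion) inherited from $\mathrm{Con}\, K$. *)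

theory Defs
  imports "HOL-Algebra.Lattice"
begin

definition lattice_congruence :: "('a, 'b) gorder_scheme \<Rightarrow> ('a \<times> 'a) set \<Rightarrow> bool" where
  "lattice_congruence K r \<longleftrightarrow>
     equiv (carrier K) r \<and>
     (\<forall>(x, x') \<in> r. \<forall>(y, y') \<in> r.
        (x \<squnion>\<^bsub>K\<^esub> y, x' \<squnion>\<^bsub>K\<^esub> y') \<in> r \<and>
        (x \<sqinter>\<^bsub>K\<^esub> y, x' \<sqinter>\<^bsub>K\<^esub> y') \<in> r)"

definition Con :: "('a, 'b) gorder_scheme \<Rightarrow> ('a \<times> 'a) set gorder" where
  "Con K = \<lparr>carrier = {r. lattice_congruence K r}, eq = (=), le = (\<subseteq>)\<rparr>"

definition con :: "('a, 'b) gorder_scheme \<Rightarrow> 'a \<Rightarrow> 'a \<Rightarrow> ('a \<times> 'a) set" where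
  "con K a b = \<Inter> {r \<in> carrier (Con K). (a, b) \<in> r}"

definition Princ :: "('a, 'b) gorder_scheme \<Rightarrow> ('a \<times> 'a) set gorder" where
  "Princ K = (Con K)\<lparr>carrier := {con K a b | a b. a \<in> carrier K \<and> b \<in> carrier K}\<rparr>"

definition order_isomorphic :: "('a, 'c) gorder_scheme \<Rightarrow> ('b, 'd) gorder_scheme \<Rightarrow> bool" where
  "order_isomorphic A B \<longleftrightarrow> (\<exists>f. bij_betw f (carrier A) (carrier B) \<and> order_emb A B f)"

lemma lattice_congruence_full:
  assumes "lattice K"
  shows "lattice_congruence K (carrier K \<times> carrier K)"
proof -
  interpret lattice K by fact
  have "equiv (carrier K) (carrier K \<times> carrier K)"
    by (rule equivI) (simp_all add: refl_on_def sym_def trans_def)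
  then show ?thesis
    unfolding lattice_congruence_def by (simp add: join_closed meet_closed)
qed

lemma lattice_congruence_Inter:
  assumes ne: "S \<noteq> {}" and cong: "\<And>r. r \<in> S \<Longrightarrow> lattice_congruence K r"
  shows "lattice_congruence K (\<Inter> S)"
proof -
  have eqv: "equiv (carrier K) r" if "r \<in> S" for r
    using cong[OF that] by (simp add: lattice_congruence_def)
  have "equiv (carrier K) (\<Inter> S)"
  proof (rule equivI)
    show "\<Inter> S \<subseteq> carrier K \<times> carrier K"
      using ne eqv unfolding equiv_def by blast
    show "refl_on (carrier K) (\<Inter> S)"
      using eqv unfolding equiv_def refl_on_def by blast
    show "sym (\<Inter> S)"
      using eqv unfolding equiv_def sym_def by blast
    show "trans (\<Inter> S)"
      using eqv unfolding equiv_def trans_def by blast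
  qed
  moreover have "(x \<squnion>\<^bsub>K\<^esub> y, x' \<squnion>\<^bsub>K\<^esub> y') \<in> r \<and> (x \<sqinter>\<^bsub>K\<^esub> y, x' \<sqinter>\<^bsub>K\<^esub> y') \<in> r"
    if "r \<in> S" "(x, x') \<in> r" "(y, y') \<in> r" for r x x' y y'
    using cong[OF that(1)] that(2,3) unfolding lattice_congruence_def by blast
  ultimately show ?thesis
    unfolding lattice_congruence_def by blast
qed

lemma con_least:
  assumes "lattice K" and "a \<in> carrier K" and "b \<in> carrier K"
  shows "least (Con K) (con K a b) {r \<in> carrier (Con K). (a, b) \<in> r}"
proof -
  let ?S = "{r \<in> carrier (Con K). (a, b) \<in> r}"
  have "carrier K \<times> carrier K \<in> ?S"
    using assms lattice_congruence_full[OF assms(1)] by (simp add: Con_def)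
  then have "lattice_congruence K (\<Inter> ?S)"
    by (intro lattice_congruence_Inter) (blast, simp add: Con_def)
  then have "con K a b \<in> ?S"
    by (simp add: con_def Con_def)
  moreover have "con K a b \<subseteq> r" if "r \<in> ?S" for r
    using that unfolding con_def by blast
  ultimately show ?thesis
    by (simp add: least_def Con_def Collect_mono)
qed

(* HOL has no existential quantification over types. A lattice that is asserted to exist over a
   poset on 'a therefore lives on nat \<times> 'a \<times> 'a, which has room for a copy of every carrier of
   cardinality at most max(aleph_0, card 'a). *)

end

theory Submission
  imports Defs
begin

text \<open>
  If \<open>0 = 1\<close>, a lattice with one element will do. Otherwise each inner element \<open>p\<close> of
  \<open>P\<close>, that is each one other than \<open>0\<close> and \<open>1\<close>, receives a chain \<open>0 < a\<^sub>p < b\<^sub>p\<close>, and the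
  congruence generated by the prime interval \<open>[a\<^sub>p, b\<^sub>p]\<close> is to represent \<open>p\<close>. For inner
  \<open>p < q\<close> the two chains are linked by three new elements \<open>d < e < g\<close>:
  \<open>d = a\<^sub>p \<squnion> a\<^sub>q\<close>, \<open>e = b\<^sub>p \<squnion> a\<^sub>q\<close> and \<open>g = a\<^sub>p \<squnion> b\<^sub>q = b\<^sub>p \<squnion> b\<^sub>q\<close>. Joining with
  \<open>a\<^sub>p\<close> moves \<open>[a\<^sub>q, b\<^sub>q]\<close> up to \<open>[d, g]\<close>, which contains \<open>[d, e]\<close>, and meeting with \<open>b\<^sub>p\<close>
  moves \<open>[d, e]\<close> down to \<open>[a\<^sub>p, b\<^sub>p]\<close>; so collapsing \<open>[a\<^sub>q, b\<^sub>q]\<close> collapses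
  \<open>[a\<^sub>p, b\<^sub>p]\<close>. Nothing flows in the other direction, because \<open>d \<sqinter> b\<^sub>q = e \<sqinter> b\<^sub>q = a\<^sub>q\<close>.
  All other joins of elements of different chains or links are the top element, and three
  further atoms lie in no link.

  The verification becomes uniform once every element is written as a function to
  \<open>{0, 1, 2}\<close> that records how far up each chain the element reaches. The order and the
  meet are then pointwise, and the join has the closed form \<open>vee\<close>. Two facts
  determine all principal congruences. If \<open>f\<close> and \<open>g\<close> have different supports,
  then some atom is identified with the bottom; as there are two other atoms that are joined
  with it to the top, everything collapses (\<open>supp_split_total\<close>). If they have the same support
  and \<open>f \<noteq> g\<close>, their places of difference have a greatest element \<open>t\<close>, and they generate
  the same congruence as the pair \<open>a\<^sub>t, b\<^sub>t\<close> (\<open>con_same_supp\<close>). That congruence relates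
  functions with the same support that differ only at places below or equal to \<open>t\<close>
  (\<open>collapse_congruence\<close>, \<open>collapse_below_least\<close>). Hence the principal congruences are
  the identity, the total relation and one congruence for each inner \<open>t\<close>, and they are
  ordered as in \<open>P\<close>.

  Finally, a level function is determined by a small number and two elements of \<open>P\<close>, so the
  lattice can be carried over to triples without changing the order of its principal
  congruences.
\<close>

section \<open>Congruences and isomorphisms\<close>

lemma con_eqI:
  assumes "lattice_congruence K r" "(a, b) \<in> r"
    and "\<And>s. lattice_congruence K s \<Longrightarrow> (a, b) \<in> s \<Longrightarrow> r \<subseteq> s"
  shows "con K a b = r"
  using assms unfolding con_def Con_def by auto

lemma con_congruence:
  assumes "lattice K" "a \<in> carrier K" "b \<in> carrier K"
  shows "lattice_congruence K (con K a b)" "(a, b) \<in> con K a b"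
  using least_mem[OF con_least[OF assms]] by (auto simp: Con_def)

lemma con_subset:
  assumes "lattice_congruence K s" "(a, b) \<in> s"
  shows "con K a b \<subseteq> s"
  unfolding con_def by (rule Inter_lower) (use assms in \<open>simp add: Con_def\<close>)

lemma congruence_subset: "lattice_congruence K r \<Longrightarrow> r \<subseteq> carrier K \<times> carrier K"
  by (simp add: lattice_congruence_def equiv_def)

lemma partial_order_Princ: "partial_order (Princ K)"
  by unfold_locales (auto simp: Princ_def Con_def)

lemma carrier_Princ: "carrier (Princ K) = {con K a b |a b. a \<in> carrier K \<and> b \<in> carrier K}"
  and le_Princ: "le (Princ K) = (\<subseteq>)"
  by (simp_all add: Princ_def Con_def)

lemma con_in_Princ: "a \<in> carrier K \<Longrightarrow> b \<in> carrier K \<Longrightarrow> con K a b \<in> carrier (Princ K)"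
  by (auto simp: carrier_Princ)

lemma in_PrincE:
  assumes "r \<in> carrier (Princ K)"
  obtains a b where "a \<in> carrier K" "b \<in> carrier K" "r = con K a b"
  using assms by (auto simp: carrier_Princ)

lemma join_eqI:
  assumes "partial_order L" "least L s (Upper L {x, y})"
  shows "x \<squnion>\<^bsub>L\<^esub> y = s"
proof -
  interpret partial_order L by fact
  show ?thesis unfolding join_def sup_def
    using assms(2) by (blast intro: some_equality least_unique)
qed

lemma meet_eqI:
  assumes "partial_order L" "greatest L s (Lower L {x, y})"
  shows "x \<sqinter>\<^bsub>L\<^esub> y = s"
proof -
  interpret partial_order L by fact
  show ?thesis unfolding meet_def inf_def
    using assms(2) by (blast intro: some_equality greatest_unique)
qed

text \<open>
  The order of principal congruences is an invariant of the isomorphism type of a lattice. This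
  allows the construction to be done with functions and its result to be moved to another type
  afterwards.
\<close>

locale lattice_iso = L: lattice L + K: lattice K
  for L :: "'b gorder" and K :: "'c gorder" +
  fixes h :: "'b \<Rightarrow> 'c"
  assumes bij: "bij_betw h (carrier L) (carrier K)"
    and emb: "\<And>x y. x \<in> carrier L \<Longrightarrow> y \<in> carrier L \<Longrightarrow> h x \<sqsubseteq>\<^bsub>K\<^esub> h y \<longleftrightarrow> x \<sqsubseteq>\<^bsub>L\<^esub> y"
begin

lemma h_closed: "x \<in> carrier L \<Longrightarrow> h x \<in> carrier K"
  using bij by (auto simp: bij_betw_def)

lemma h_inj: "x \<in> carrier L \<Longrightarrow> y \<in> carrier L \<Longrightarrow> h x = h y \<Longrightarrow> x = y"
  using bij by (auto simp: bij_betw_def dest: inj_onD)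

lemma h_surj:
  assumes "z \<in> carrier K" obtains x where "x \<in> carrier L" "z = h x"
  using assms bij by (auto simp: bij_betw_def)

lemma join_h:
  assumes "x \<in> carrier L" "y \<in> carrier L"
  shows "h x \<squnion>\<^bsub>K\<^esub> h y = h (x \<squnion>\<^bsub>L\<^esub> y)"
proof (rule join_eqI)
  show "partial_order K" by unfold_locales
  show "least K (h (x \<squnion>\<^bsub>L\<^esub> y)) (Upper K {h x, h y})"
  proof (rule least_UpperI)
    fix z assume "z \<in> Upper K {h x, h y}"
    then have "z \<in> carrier K" "h x \<sqsubseteq>\<^bsub>K\<^esub> z" "h y \<sqsubseteq>\<^bsub>K\<^esub> z"
      using assms by (auto simp: Upper_def h_closed)
    then show "h (x \<squnion>\<^bsub>L\<^esub> y) \<sqsubseteq>\<^bsub>K\<^esub> z"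
      using assms by (elim h_surj) (simp add: emb L.join_le)
  qed (use assms in \<open>auto simp: emb h_closed L.join_left L.join_right\<close>)
qed

lemma meet_h:
  assumes "x \<in> carrier L" "y \<in> carrier L"
  shows "h x \<sqinter>\<^bsub>K\<^esub> h y = h (x \<sqinter>\<^bsub>L\<^esub> y)"
proof (rule meet_eqI)
  show "partial_order K" by unfold_locales
  show "greatest K (h (x \<sqinter>\<^bsub>L\<^esub> y)) (Lower K {h x, h y})"
  proof (rule greatest_LowerI)
    fix z assume "z \<in> Lower K {h x, h y}"
    then have "z \<in> carrier K" "z \<sqsubseteq>\<^bsub>K\<^esub> h x" "z \<sqsubseteq>\<^bsub>K\<^esub> h y"
      using assms by (auto simp: Lower_def h_closed)
    then show "z \<sqsubseteq>\<^bsub>K\<^esub> h (x \<sqinter>\<^bsub>L\<^esub> y)"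
      using assms by (elim h_surj) (simp add: emb L.meet_le)
  qed (use assms in \<open>auto simp: emb h_closed L.meet_left L.meet_right\<close>)
qed

lemma congruence_image:
  assumes "lattice_congruence L r"
  shows "lattice_congruence K (map_prod h h ` r)"
proof -
  have r: "equiv (carrier L) r" and sub: "r \<subseteq> carrier L \<times> carrier L"
    using assms congruence_subset by (auto simp: lattice_congruence_def)
  have ops: "(x \<squnion>\<^bsub>L\<^esub> y, x' \<squnion>\<^bsub>L\<^esub> y') \<in> r" "(x \<sqinter>\<^bsub>L\<^esub> y, x' \<sqinter>\<^bsub>L\<^esub> y') \<in> r"
    if "(x, x') \<in> r" "(y, y') \<in> r" for x x' y y'
    using assms that by (auto simp: lattice_congruence_def)
  have "equiv (carrier K) (map_prod h h ` r)"
  proof (rule equivI)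
    show "map_prod h h ` r \<subseteq> carrier K \<times> carrier K"
      using sub h_closed by auto
    show "refl_on (carrier K) (map_prod h h ` r)"
    proof (rule refl_onI)
      fix z assume "z \<in> carrier K"
      then obtain x where "x \<in> carrier L" "z = h x" by (rule h_surj)
      then show "(z, z) \<in> map_prod h h ` r"
        using r by (auto simp: equiv_def refl_on_def intro!: rev_image_eqI[of "(x, x)"])
    qed
    show "sym (map_prod h h ` r)"
      using r by (fastforce simp: sym_def equiv_def)
    show "trans (map_prod h h ` r)"
    proof (rule transI)
      fix a b c assume "(a, b) \<in> map_prod h h ` r" "(b, c) \<in> map_prod h h ` r"
      then obtain x y y' z where "(x, y) \<in> r" "(y', z) \<in> r" "a = h x" "h y' = h y" "c = h z"
        by auto
      moreover from this have "y' = y" using sub h_inj by blast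
      ultimately show "(a, c) \<in> map_prod h h ` r"
        using r by (auto simp: equiv_def dest: transD)
    qed
  qed
  moreover have "(h x \<squnion>\<^bsub>K\<^esub> h y, h x' \<squnion>\<^bsub>K\<^esub> h y') \<in> map_prod h h ` r \<and>
      (h x \<sqinter>\<^bsub>K\<^esub> h y, h x' \<sqinter>\<^bsub>K\<^esub> h y') \<in> map_prod h h ` r"
    if "(x, x') \<in> r" "(y, y') \<in> r" for x x' y y'
  proof -
    have "x \<in> carrier L" "x' \<in> carrier L" "y \<in> carrier L" "y' \<in> carrier L"
      using that sub by auto
    then show ?thesis using ops[OF that] by (auto simp: join_h meet_h)
  qed
  ultimately show ?thesis
    by (auto simp: lattice_congruence_def)
qed

lemma iso_inverse: "lattice_iso K L (inv_into (carrier L) h)"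
proof (intro lattice_iso.intro lattice_iso_axioms.intro)
  show "lattice K" "lattice L" by unfold_locales
  show "bij_betw (inv_into (carrier L) h) (carrier K) (carrier L)"
    by (rule bij_betw_inv_into[OF bij])
  show "inv_into (carrier L) h x \<sqsubseteq>\<^bsub>L\<^esub> inv_into (carrier L) h y \<longleftrightarrow> x \<sqsubseteq>\<^bsub>K\<^esub> y"
    if "x \<in> carrier K" "y \<in> carrier K" for x y
    using that bij by (elim h_surj) (simp add: emb bij_betw_inv_into_left)
qed

lemma con_h:
  assumes "a \<in> carrier L" "b \<in> carrier L"
  shows "con K (h a) (h b) = map_prod h h ` con L a b"
proof (rule con_eqI)
  show "lattice_congruence K (map_prod h h ` con L a b)"
    using assms L.lattice_axioms by (intro congruence_image con_congruence)
  show "(h a, h b) \<in> map_prod h h ` con L a b"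
    using con_congruence(2)[OF L.lattice_axioms assms] by (auto intro: rev_image_eqI)
next
  fix s assume s: "lattice_congruence K s" "(h a, h b) \<in> s"
  define g where "g = inv_into (carrier L) h"
  have gh: "g (h x) = x" if "x \<in> carrier L" for x
    using that bij by (simp add: g_def bij_betw_inv_into_left)
  have hg: "h (g z) = z" if "z \<in> carrier K" for z
    using that bij by (simp add: g_def bij_betw_inv_into_right)
  have "lattice_congruence L (map_prod g g ` s)"
    unfolding g_def by (rule lattice_iso.congruence_image[OF iso_inverse s(1)])
  moreover have "(a, b) \<in> map_prod g g ` s"
    using gh assms by (intro rev_image_eqI[OF s(2)]) simp
  ultimately have "con L a b \<subseteq> map_prod g g ` s"
    by (rule con_subset)
  then have "map_prod h h ` con L a b \<subseteq> map_prod h h ` map_prod g g ` s"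
    by (rule image_mono)
  also have "\<dots> = (\<lambda>z. z) ` s"
    unfolding image_image using congruence_subset[OF s(1)] hg by (intro image_cong) auto
  finally show "map_prod h h ` con L a b \<subseteq> s"
    by simp
qed

lemma Princ_iso:
  assumes "order_isomorphic P (Princ L)"
  shows "order_isomorphic P (Princ K)"
proof -
  obtain f where f: "bij_betw f (carrier P) (carrier (Princ L))" "order_emb P (Princ L) f"
    using assms by (auto simp: order_isomorphic_def)
  define F where "F = image (map_prod h h)"
  have in_sub: "r \<subseteq> carrier L \<times> carrier L" if "r \<in> carrier (Princ L)" for r
  proof -
    obtain a b where "a \<in> carrier L" "b \<in> carrier L" "r = con L a b"
      using \<open>r \<in> carrier (Princ L)\<close> by (rule in_PrincE)
    then show ?thesis
      by (simp add: congruence_subset con_congruence(1)[OF L.lattice_axioms])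
  qed
  have inj: "inj_on (map_prod h h) (carrier L \<times> carrier L)"
    using bij by (intro map_prod_inj_on) (auto simp: bij_betw_def)
  have F_le: "F r \<subseteq> F s \<longleftrightarrow> r \<subseteq> s" if "r \<in> carrier (Princ L)" "s \<in> carrier (Princ L)" for r s
  proof
    assume sub: "F r \<subseteq> F s"
    show "r \<subseteq> s"
    proof
      fix z assume z: "z \<in> r"
      then have "map_prod h h z \<in> F s" using sub by (auto simp only: F_def)
      then obtain w where w: "map_prod h h z = map_prod h h w" "w \<in> s"
        unfolding F_def by (rule imageE)
      have "z = w"
        using subsetD[OF in_sub[OF that(1)] z] subsetD[OF in_sub[OF that(2)] w(2)]
        by (rule inj_onD[OF inj w(1)])
      then show "z \<in> s" using w(2) by simp
    qed
  next
    assume "r \<subseteq> s" then show "F r \<subseteq> F s" unfolding F_def by (rule image_mono)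
  qed
  have F_con: "F (con L a b) = con K (h a) (h b)" if "a \<in> carrier L" "b \<in> carrier L" for a b
    using con_h[OF that] by (simp add: F_def)
  have "F ` carrier (Princ L) = carrier (Princ K)"
  proof (intro equalityI subsetI)
    fix c assume "c \<in> F ` carrier (Princ L)"
    then obtain r where r: "c = F r" "r \<in> carrier (Princ L)" by (rule imageE)
    from r(2) obtain a b where ab: "a \<in> carrier L" "b \<in> carrier L" "r = con L a b"
      by (rule in_PrincE)
    show "c \<in> carrier (Princ K)"
      unfolding r(1) ab(3) F_con[OF ab(1,2)] using ab(1,2) by (intro con_in_Princ h_closed)
  next
    fix c assume "c \<in> carrier (Princ K)"
    then obtain x y where xy: "x \<in> carrier K" "y \<in> carrier K" "c = con K x y"
      by (rule in_PrincE)
    obtain a where a: "a \<in> carrier L" "x = h a" using xy(1) by (rule h_surj)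
    obtain b where b: "b \<in> carrier L" "y = h b" using xy(2) by (rule h_surj)
    have "c = F (con L a b)" using F_con a b xy(3) by simp
    then show "c \<in> F ` carrier (Princ L)"
      using con_in_Princ[OF a(1) b(1)] by (rule image_eqI)
  qed
  moreover have "inj_on F (carrier (Princ L))"
  proof (rule inj_onI)
    fix r s assume "r \<in> carrier (Princ L)" "s \<in> carrier (Princ L)" "F r = F s"
    then show "r = s" using F_le[of r s] F_le[of s r] by simp
  qed
  ultimately have "bij_betw F (carrier (Princ L)) (carrier (Princ K))"
    by (simp add: bij_betw_def)
  then have "bij_betw (F \<circ> f) (carrier P) (carrier (Princ K))"
    by (rule bij_betw_trans[OF f(1)])
  moreover have "order_emb P (Princ K) (F \<circ> f)"
    unfolding order_emb_def
  proof (intro conjI ballI)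
    show "weak_partial_order P" using f(2) by (simp add: order_emb_def)
    show "weak_partial_order (Princ K)"
      by (rule partial_order.axioms(1)[OF partial_order_Princ])
    fix x y assume xy: "x \<in> carrier P" "y \<in> carrier P"
    then have "f x \<in> carrier (Princ L)" "f y \<in> carrier (Princ L)"
      using f(1) by (auto simp: bij_betw_def)
    then show "(F \<circ> f) x \<sqsubseteq>\<^bsub>Princ K\<^esub> (F \<circ> f) y \<longleftrightarrow> x \<sqsubseteq>\<^bsub>P\<^esub> y"
      using f(2) xy F_le by (simp add: order_emb_def le_Princ)
  qed
  ultimately show ?thesis
    by (auto simp: order_isomorphic_def)
qed

end

text \<open>
  Transport of structure along an injection: the order of the image is the one pulled back along
  the inverse.
\<close>

lemma bounded_lattice_on_image:
  fixes L :: "'b gorder" and h :: "'b \<Rightarrow> 'c"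
  assumes "bounded_lattice L" and inj: "inj_on h (carrier L)"
  obtains K :: "'c gorder"
  where "bounded_lattice K" "carrier K = h ` carrier L" "lattice_iso L K h"
proof -
  interpret L: bounded_lattice L by fact
  define g where "g = inv_into (carrier L) h"
  define K :: "'c gorder" where "K = \<lparr>carrier = h ` carrier L, eq = (=), le = (\<lambda>x y. g x \<sqsubseteq>\<^bsub>L\<^esub> g y)\<rparr>"
  have gh: "g (h x) = x" if "x \<in> carrier L" for x
    using that inj by (simp add: g_def)
  interpret K: partial_order K
    by unfold_locales (auto simp: K_def gh intro: L.le_trans arg_cong[of _ _ h, OF L.le_antisym])
  have "\<exists>s. least K s (Upper K {h x, h y})" if "x \<in> carrier L" "y \<in> carrier L" for x y
  proof -
    have "least K (h (x \<squnion>\<^bsub>L\<^esub> y)) (Upper K {h x, h y})"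
      using that by (auto simp: least_def Upper_def K_def gh L.join_left L.join_right intro!: L.join_le)
    then show ?thesis ..
  qed
  moreover have "\<exists>s. greatest K s (Lower K {h x, h y})" if "x \<in> carrier L" "y \<in> carrier L" for x y
  proof -
    have "greatest K (h (x \<sqinter>\<^bsub>L\<^esub> y)) (Lower K {h x, h y})"
      using that by (auto simp: greatest_def Lower_def K_def gh L.meet_left L.meet_right intro!: L.meet_le)
    then show ?thesis ..
  qed
  moreover have "least K (h \<bottom>\<^bsub>L\<^esub>) (carrier K)" "greatest K (h \<top>\<^bsub>L\<^esub>) (carrier K)"
    by (auto simp: least_def greatest_def K_def gh)
  ultimately have K: "bounded_lattice K"
    by unfold_locales (auto simp: K_def)
  then interpret K: bounded_lattice K .
  have "lattice_iso L K h"
    by unfold_locales (use inj in \<open>auto simp: K_def gh bij_betw_def\<close>)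
  then show thesis using K that by (simp add: K_def)
qed

section \<open>A lattice of level functions\<close>

text \<open>
  The indices in \<open>H\<close> carry chains of two levels and those in \<open>U\<close> atoms outside all links.
  At least three elements in \<open>U\<close> are what the last assumption amounts to: whichever atom \<open>j\<close> gets
  identified with the bottom, two more atoms \<open>u \<noteq> v\<close> must remain whose joins with \<open>j\<close> are the
  top, for then \<open>u\<close>, \<open>v\<close> and so \<open>u \<sqinter> v\<close>, the bottom, become congruent to the top.
\<close>

locale level_frame =
  fixes H U :: "'j set" and prec :: "'j \<Rightarrow> 'j \<Rightarrow> bool" (infix \<open>\<prec>\<close> 50)
  assumes prec_trans: "p \<prec> q \<Longrightarrow> q \<prec> r \<Longrightarrow> p \<prec> r"
    and prec_irrefl: "\<not> p \<prec> p"
    and prec_mem: "p \<prec> q \<Longrightarrow> p \<in> H \<and> q \<in> H"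
    and disjoint: "H \<inter> U = {}"
    and two_others: "\<exists>u\<in>U. \<exists>v\<in>U. u \<noteq> v \<and> u \<noteq> j \<and> v \<noteq> j"
begin

text \<open>
  The top element of the lattice. At an index in \<open>U\<close> there is only one level above \<open>0\<close>, so such an
  index contributes no interval \<open>[a, b]\<close> and no congruence of its own.
\<close>

definition cap :: "'j \<Rightarrow> nat" where
  "cap j = (if j \<in> H then 2 else if j \<in> U then 1 else 0)"

definition supp :: "('j \<Rightarrow> nat) \<Rightarrow> 'j set" where
  "supp f = {j. f j \<noteq> 0}"

text \<open>
  The admissible supports of elements other than the top: the empty set, the singletons and the
  pairs \<open>p \<prec> q\<close>. As supports are chains, two functions with the same support that differ have a
  greatest place of difference, which is why they generate the congruence of a single index.
  Larger chains would do as well, but two indices per element keep the elements easy to encode.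
\<close>

definition face :: "'j set \<Rightarrow> bool" where
  "face S \<longleftrightarrow> (\<exists>p q. S \<subseteq> {p, q} \<and> (p = q \<or> p \<prec> q))"

text \<open>
  The asymmetry between \<open>p \<prec> q\<close> in a link: there the level \<open>2\<close> at \<open>q\<close> forces the level \<open>2\<close> at
  \<open>p\<close>. This is what makes \<open>[a\<^sub>q, b\<^sub>q]\<close> dominate \<open>[a\<^sub>p, b\<^sub>p]\<close>.
\<close>

definition closed :: "('j \<Rightarrow> nat) \<Rightarrow> bool" where
  "closed f \<longleftrightarrow> (\<forall>p q. p \<prec> q \<and> f p \<noteq> 0 \<and> f q = 2 \<longrightarrow> f p = 2)"

definition level_funs :: "('j \<Rightarrow> nat) set" where
  "level_funs = {f. f \<le> cap \<and> closed f \<and> (f = cap \<or> face (supp f))}"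

text \<open>
  For \<open>m \<le> cap\<close> this is the least closed function above \<open>m\<close>. A single round of
  raising suffices since \<open>\<prec>\<close> is transitive.
\<close>

definition raise :: "('j \<Rightarrow> nat) \<Rightarrow> 'j \<Rightarrow> nat" where
  "raise m p = (if m p \<noteq> 0 \<and> (\<exists>q. p \<prec> q \<and> m q = 2) then 2 else m p)"

definition vee :: "('j \<Rightarrow> nat) \<Rightarrow> ('j \<Rightarrow> nat) \<Rightarrow> 'j \<Rightarrow> nat" where
  "vee f g = (if face (supp f \<union> supp g) then raise (sup f g) else cap)"

text \<open>
  At an index \<open>t \<in> H\<close>, \<open>point t 1\<close> and \<open>point t 2\<close> are the elements \<open>a\<^sub>t < b\<^sub>t\<close> of the chain
  of \<open>t\<close>.
\<close>

definition point :: "'j \<Rightarrow> nat \<Rightarrow> 'j \<Rightarrow> nat" where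
  "point j k = (\<lambda>i. if i = j then k else 0)"

definition L :: "('j \<Rightarrow> nat) gorder" where
  "L = \<lparr>carrier = level_funs, eq = (=), le = (\<le>)\<rparr>"

lemma face_mono: "face T \<Longrightarrow> S \<subseteq> T \<Longrightarrow> face S"
  unfolding face_def by blast

lemma cap_le_2: "cap j \<le> 2"
  by (simp add: cap_def)

lemma level_le_cap: "f \<in> level_funs \<Longrightarrow> f j \<le> cap j"
  by (auto simp: level_funs_def le_fun_def)

lemma level_le_2: "f \<in> level_funs \<Longrightarrow> f j \<le> 2"
  using level_le_cap[of f j] cap_le_2[of j] by linarith

lemma closedD: "f \<in> level_funs \<Longrightarrow> p \<prec> q \<Longrightarrow> f p \<noteq> 0 \<Longrightarrow> f q = 2 \<Longrightarrow> f p = 2"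
  by (auto simp: level_funs_def closed_def)

lemma face_supp: "f \<in> level_funs \<Longrightarrow> f \<noteq> cap \<Longrightarrow> face (supp f)"
  by (simp add: level_funs_def)

lemma not_face_U:
  assumes "u \<in> U" "j \<noteq> u" "{u, j} \<subseteq> S" shows "\<not> face S"
  using assms disjoint prec_mem unfolding face_def by blast

lemma not_face_cap: "\<not> face (supp cap)"
proof -
  obtain u v where "u \<in> U" "v \<in> U" "u \<noteq> v" using two_others by blast
  then show ?thesis
    using disjoint by (intro not_face_U[of u v]) (auto simp: supp_def cap_def)
qed

lemma supp_bot_cap: "supp (\<lambda>_. 0) \<noteq> supp cap"
proof -
  have "face (supp (\<lambda>_. 0))" by (auto simp: face_def supp_def)
  then show ?thesis using not_face_cap by metis
qed

lemma supp_mono: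
  assumes "f \<le> g" shows "supp f \<subseteq> supp g"
proof
  fix j assume "j \<in> supp f"
  then show "j \<in> supp g" using le_funD[OF assms, of j] by (simp add: supp_def)
qed

lemma supp_inf: "supp (inf f g) = supp f \<inter> supp g"
  by (auto simp: supp_def inf_nat_def min_def)

lemma supp_raise: "supp (raise (sup f g)) = supp f \<union> supp g"
  by (auto simp: supp_def raise_def sup_nat_def max_def)

lemma cap_in: "cap \<in> level_funs"
  by (auto simp: level_funs_def closed_def cap_def dest: prec_mem)

lemma point_in: "k \<le> cap j \<Longrightarrow> point j k \<in> level_funs"
  using prec_irrefl
  by (auto simp: level_funs_def closed_def point_def le_fun_def face_def supp_def)

lemma bot_in: "(\<lambda>_. 0) \<in> level_funs"
  using point_in[of 0] by (simp add: point_def)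

lemma inf_in:
  assumes "f \<in> level_funs" "g \<in> level_funs" shows "inf f g \<in> level_funs"
proof -
  have "closed (inf f g)"
    using closedD[OF assms(1)] closedD[OF assms(2)] level_le_2[OF assms(1)] level_le_2[OF assms(2)]
    unfolding closed_def by (auto simp: inf_nat_def min_def split: if_splits) (metis le_antisym)+
  moreover have "inf f g \<le> cap"
    using assms by (auto simp: level_funs_def intro: le_infI1)
  moreover have "face (supp (inf f g))" if "inf f g \<noteq> cap"
  proof -
    have "f \<noteq> cap \<or> g \<noteq> cap" using that by auto
    then show ?thesis
      using assms face_supp face_mono by (metis supp_inf inf_le1 inf_le2)
  qed
  ultimately show ?thesis by (auto simp: level_funs_def)
qed

lemma raise_le:
  assumes "h \<in> level_funs" "m \<le> h" shows "raise m \<le> h"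
proof (rule le_funI)
  fix p
  have m: "m j \<le> h j" for j using assms(2) by (simp add: le_fun_def)
  show "raise m p \<le> h p"
  proof (cases "m p \<noteq> 0 \<and> (\<exists>q. p \<prec> q \<and> m q = 2)")
    case True
    then obtain q where q: "p \<prec> q" "m q = 2" "m p \<noteq> 0" by blast
    have "h q = 2" "h p \<noteq> 0"
      using m[of q] m[of p] q level_le_2[OF assms(1), of q] by auto
    then have "h p = 2" using closedD[OF assms(1)] q(1) by blast
    then show ?thesis using True by (simp add: raise_def)
  next
    case False
    then have "raise m p = m p" by (auto simp: raise_def)
    then show ?thesis using m[of p] by simp
  qed
qed

lemma vee_in:
  assumes "f \<in> level_funs" "g \<in> level_funs" shows "vee f g \<in> level_funs"
proof (cases "face (supp f \<union> supp g)")
  case True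
  have "raise (sup f g) \<le> cap"
    using assms by (intro raise_le cap_in le_supI) (auto simp: level_funs_def)
  moreover have "closed (raise (sup f g))"
    unfolding closed_def raise_def by (auto split: if_splits intro: prec_trans)
  ultimately show ?thesis
    using True by (simp add: vee_def level_funs_def supp_raise)
qed (simp add: vee_def cap_in)

lemma vee_upper:
  assumes "f \<in> level_funs" "g \<in> level_funs" shows "f \<le> vee f g" "g \<le> vee f g"
proof -
  have "sup f g j \<le> raise (sup f g) j" for j
    using level_le_2[OF assms(1), of j] level_le_2[OF assms(2), of j]
    by (auto simp: raise_def)
  then have "sup f g \<le> raise (sup f g)" by (rule le_funI)
  then show "f \<le> vee f g" "g \<le> vee f g"
    using level_le_cap assms by (auto simp: vee_def le_fun_def)
qed

text \<open>
  An upper bound of \<open>f\<close> and \<open>g\<close> has a support containing both supports, so if their union is no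
  face, the only upper bound is the top.
\<close>

lemma vee_least:
  assumes "h \<in> level_funs" "f \<le> h" "g \<le> h" shows "vee f g \<le> h"
proof (cases "face (supp f \<union> supp g)")
  case True
  then show ?thesis using assms by (simp add: vee_def raise_le)
next
  case False
  have "supp f \<union> supp g \<subseteq> supp h"
    using assms by (simp add: supp_mono)
  then have "h = cap" using False assms(1) face_supp face_mono by blast
  then show ?thesis using False by (simp add: vee_def)
qed

lemma carrier_L [simp]: "carrier L = level_funs" and le_L [simp]: "le L = (\<le>)" and eq_L [simp]: "eq L = (=)"
  by (simp_all add: L_def)

lemma partial_order_L: "partial_order L"
  by unfold_locales auto

lemma least_vee: "f \<in> level_funs \<Longrightarrow> g \<in> level_funs \<Longrightarrow> least L (vee f g) (Upper L {f, g})"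
  using vee_in vee_upper vee_least by (auto simp: least_def Upper_def)

lemma greatest_inf: "f \<in> level_funs \<Longrightarrow> g \<in> level_funs \<Longrightarrow> greatest L (inf f g) (Lower L {f, g})"
  using inf_in by (auto simp: greatest_def Lower_def)

lemma bounded_lattice_L: "bounded_lattice L"
proof -
  interpret partial_order L by (rule partial_order_L)
  have "least L (\<lambda>_. 0) (carrier L)" "greatest L cap (carrier L)"
    using bot_in cap_in by (auto simp: least_def greatest_def le_fun_def level_le_cap)
  then show ?thesis
    using least_vee greatest_inf by unfold_locales (metis carrier_L)+
qed

lemma lattice_L: "lattice L"
  using bounded_lattice_L by (simp add: bounded_lattice_def)

lemma join_L: "f \<in> level_funs \<Longrightarrow> g \<in> level_funs \<Longrightarrow> f \<squnion>\<^bsub>L\<^esub> g = vee f g"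
  by (rule join_eqI[OF partial_order_L least_vee])

lemma meet_L: "f \<in> level_funs \<Longrightarrow> g \<in> level_funs \<Longrightarrow> f \<sqinter>\<^bsub>L\<^esub> g = inf f g"
  by (rule meet_eqI[OF partial_order_L greatest_inf])

section \<open>Principal congruences of the lattice of level functions\<close>

text \<open>
  The bottom and the top are the only level functions with their supports, so they stay alone in
  their classes; this is what keeps these relations from spreading.
\<close>

definition collapse :: "'j set \<Rightarrow> (('j \<Rightarrow> nat) \<times> ('j \<Rightarrow> nat)) set" where
  "collapse D = {(f, g). f \<in> level_funs \<and> g \<in> level_funs \<and> supp f = supp g \<and> (\<forall>s. f s \<noteq> g s \<longrightarrow> s \<in> D)}"

definition below :: "'j \<Rightarrow> 'j set" where
  "below t = {s. s = t \<or> s \<prec> t}"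

text \<open>
  Only supports decide whether a join is the top, and they agree on both sides. Otherwise a
  difference of the joins at \<open>x\<close> comes from a difference of the arguments at \<open>x\<close> itself or at
  some \<open>q\<close> above \<open>x\<close> that raises \<open>x\<close> on one side only; in the latter case \<open>x \<in> D\<close> because \<open>D\<close> is
  a down-set.
\<close>

lemma collapse_vee:
  assumes D: "\<And>s t. s \<prec> t \<Longrightarrow> t \<in> D \<Longrightarrow> s \<in> D"
    and fg: "(f, f') \<in> collapse D" "(g, g') \<in> collapse D"
  shows "(vee f g, vee f' g') \<in> collapse D"
proof -
  have c: "f \<in> level_funs" "f' \<in> level_funs" "g \<in> level_funs" "g' \<in> level_funs"
    and s: "supp f = supp f'" "supp g = supp g'"
    and d: "\<And>s. f s \<noteq> f' s \<or> g s \<noteq> g' s \<Longrightarrow> s \<in> D"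
    using fg by (auto simp: collapse_def)
  have "supp (vee f g) = supp (vee f' g')"
    using s by (simp add: vee_def supp_raise)
  moreover have "x \<in> D" if ne: "vee f g x \<noteq> vee f' g' x" for x
  proof -
    have ne': "raise (sup f g) x \<noteq> raise (sup f' g') x"
      using ne s by (auto simp: vee_def split: if_splits)
    show ?thesis
    proof (cases "sup f g x = sup f' g' x")
      case False
      then have "f x \<noteq> f' x \<or> g x \<noteq> g' x" by auto
      then show ?thesis by (rule d)
    next
      case True
      then obtain q where q: "x \<prec> q" "sup f g q \<noteq> sup f' g' q"
        using ne' by (auto simp: raise_def split: if_splits)
      have "f q \<noteq> f' q \<or> g q \<noteq> g' q" using q(2) by auto
      then show ?thesis using D[OF q(1)] d by blast
    qed
  qed
  ultimately show ?thesis using c by (simp add: collapse_def vee_in)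
qed

lemma collapse_inf:
  assumes "(f, f') \<in> collapse D" "(g, g') \<in> collapse D"
  shows "(inf f g, inf f' g') \<in> collapse D"
  using assms by (auto simp: collapse_def supp_inf inf_in) metis

lemma collapse_congruence:
  assumes "\<And>s t. s \<prec> t \<Longrightarrow> t \<in> D \<Longrightarrow> s \<in> D"
  shows "lattice_congruence L (collapse D)"
proof -
  have "equiv level_funs (collapse D)"
  proof (rule equivI)
    show "trans (collapse D)"
      unfolding collapse_def trans_def by (auto, metis)
  qed (auto simp: collapse_def refl_on_def sym_def)
  moreover have "f \<in> level_funs \<and> f' \<in> level_funs" if "(f, f') \<in> collapse D" for f f'
    using that by (simp add: collapse_def)
  ultimately show ?thesis
    using collapse_vee[OF assms] collapse_inf
    by (fastforce simp: lattice_congruence_def join_L meet_L)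
qed

lemma below_down: "s \<prec> t \<Longrightarrow> t \<in> below r \<Longrightarrow> s \<in> below r"
  using prec_trans by (auto simp: below_def)

context
  fixes r assumes r: "lattice_congruence L r"
begin

lemma cong_sub: "(f, g) \<in> r \<Longrightarrow> f \<in> level_funs \<and> g \<in> level_funs"
  using r by (auto simp: lattice_congruence_def equiv_def)

lemma cong_refl: "f \<in> level_funs \<Longrightarrow> (f, f) \<in> r"
  using r by (auto simp: lattice_congruence_def equiv_def refl_on_def)

lemma cong_sym: "(f, g) \<in> r \<Longrightarrow> (g, f) \<in> r"
  using r by (auto simp: lattice_congruence_def equiv_def sym_def)

lemma cong_trans: "(f, g) \<in> r \<Longrightarrow> (g, h) \<in> r \<Longrightarrow> (f, h) \<in> r"
  using r by (auto simp: lattice_congruence_def equiv_def dest: transD)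

lemma cong_vee: "(f, f') \<in> r \<Longrightarrow> (g, g') \<in> r \<Longrightarrow> (vee f g, vee f' g') \<in> r"
  using r cong_sub by (fastforce simp: lattice_congruence_def join_L)

lemma cong_inf: "(f, f') \<in> r \<Longrightarrow> (g, g') \<in> r \<Longrightarrow> (inf f g, inf f' g') \<in> r"
  using r cong_sub by (fastforce simp: lattice_congruence_def meet_L)

text \<open>
  Let \<open>u\<close> and \<open>v\<close> be two atoms outside all links and different from \<open>j\<close>. Joining
  \<open>0 \<equiv> j\<close> with each of them gives \<open>u \<equiv> 1\<close> and \<open>v \<equiv> 1\<close>, whence \<open>0 = u \<sqinter> v \<equiv> 1\<close>.
\<close>

lemma atom_collapse_total:
  assumes "point j 1 \<in> level_funs" "(\<lambda>_. 0, point j 1) \<in> r"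
  shows "r = level_funs \<times> level_funs"
proof -
  obtain u v where uv: "u \<in> U" "v \<in> U" "u \<noteq> v" "u \<noteq> j" "v \<noteq> j"
    using two_others by blast
  have in_carr: "point w 1 \<in> level_funs" if "w \<in> U" for w
    using that disjoint by (intro point_in) (auto simp: cap_def)
  have top: "(point w 1, cap) \<in> r" if w: "w \<in> U" "w \<noteq> j" for w
  proof -
    have "vee (\<lambda>_. 0) (point w 1) = point w 1"
      using in_carr[OF w(1)] bot_in
      by (intro antisym vee_least vee_upper) (auto simp: le_fun_def)
    moreover have "vee (point j 1) (point w 1) = cap"
      using not_face_U[OF w(1), of j "supp (point j 1) \<union> supp (point w 1)"] w(2)
      by (auto simp: vee_def supp_def point_def)
    ultimately show ?thesis
      using cong_vee[OF assms(2) cong_refl[OF in_carr[OF w(1)]]] by simp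
  qed
  have "inf (point u 1) (point v 1) = (\<lambda>_. 0)"
    using uv(3) by (auto simp: point_def fun_eq_iff inf_nat_def)
  then have bt: "(\<lambda>_. 0, cap) \<in> r"
    using cong_inf[OF top top, of u v] uv by simp
  have "(f, \<lambda>_. 0) \<in> r" if f: "f \<in> level_funs" for f
  proof -
    have "inf f (\<lambda>_. 0) = (\<lambda>_. 0)" "inf f cap = f"
      using level_le_cap[OF f] by (auto simp: min_absorb1 fun_eq_iff inf_nat_def)
    then show ?thesis
      using cong_inf[OF cong_refl[OF f] cong_sym[OF bt]] by simp
  qed
  then have "(f, g) \<in> r" if "f \<in> level_funs" "g \<in> level_funs" for f g
    using that by (intro cong_trans[of f _ g] cong_sym[of g])
  then show ?thesis
    using cong_sub by auto
qed

text \<open>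
  Meeting with the atom at an index that lies in one of the supports only identifies that atom
  with the bottom.
\<close>

lemma supp_split_total:
  assumes fg: "(f, g) \<in> r" and ne: "supp f \<noteq> supp g"
  shows "r = level_funs \<times> level_funs"
proof -
  have *: "r = level_funs \<times> level_funs" if fg: "(f, g) \<in> r" and j: "f j \<noteq> 0" "g j = 0" for f g j
  proof (rule atom_collapse_total)
    have "f \<in> level_funs" using fg cong_sub by blast
    then have "1 \<le> cap j" using j(1) level_le_cap[of f j] by linarith
    then show p: "point j 1 \<in> level_funs" by (rule point_in)
    have "inf f (point j 1) = point j 1" "inf g (point j 1) = (\<lambda>_. 0)"
      using j by (auto simp: point_def fun_eq_iff inf_nat_def min_def)
    then show "(\<lambda>_. 0, point j 1) \<in> r"
      using cong_inf[OF fg cong_refl[OF p]] cong_sym by simp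
  qed
  have "\<exists>j. (f j \<noteq> 0) \<noteq> (g j \<noteq> 0)"
  proof (rule ccontr)
    assume "\<not> ?thesis"
    then have "supp f = supp g" by (simp add: supp_def)
    with ne show False ..
  qed
  then obtain j where "f j \<noteq> 0 \<and> g j = 0 \<or> g j \<noteq> 0 \<and> f j = 0" by auto
  then show ?thesis using *[OF fg] *[OF cong_sym[OF fg]] by metis
qed

text \<open>
  The link at work: join with \<open>a\<^sub>s\<close>, then meet with \<open>b\<^sub>s\<close>. By closedness the join of \<open>b\<^sub>t\<close> and
  \<open>a\<^sub>s\<close> lies above \<open>b\<^sub>s\<close>, while the join of \<open>a\<^sub>t\<close> and \<open>a\<^sub>s\<close> does not.
\<close>

lemma cong_cell_below:
  assumes t: "(point t 1, point t 2) \<in> r" and st: "s \<prec> t"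
  shows "(point s 1, point s 2) \<in> r"
proof -
  have H: "s \<in> H" "t \<in> H" using st prec_mem by auto
  then have c: "point s 1 \<in> level_funs" "point s 2 \<in> level_funs" "point t 1 \<in> level_funs" "point t 2 \<in> level_funs"
    by (auto intro!: point_in simp: cap_def)
  have ne: "s \<noteq> t" using st prec_irrefl by auto
  have face: "face (supp (point t k) \<union> supp (point s 1))" for k
    unfolding face_def using st by (intro exI[of _ s] exI[of _ t]) (auto simp: supp_def point_def)
  have "inf (vee (point t 1) (point s 1)) (point s 2) = point s 1"
    using ne face by (auto simp: vee_def raise_def point_def fun_eq_iff inf_nat_def sup_nat_def)
  moreover have "inf (vee (point t 2) (point s 1)) (point s 2) = point s 2"
    using ne face st by (auto simp: vee_def raise_def point_def fun_eq_iff inf_nat_def sup_nat_def)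
  ultimately show ?thesis
    using cong_inf[OF cong_vee[OF t cong_refl[OF c(1)]] cong_refl[OF c(2)]] by simp
qed

end

text \<open>
  The top shares its support with no other function, so the common support is a face. Indices in
  \<open>U\<close> have just one nonzero level, so the functions can differ only inside \<open>H\<close>.
\<close>

lemma greatest_difference:
  assumes "f \<in> level_funs" "g \<in> level_funs" "supp f = supp g" "f \<noteq> g"
  obtains t where "t \<in> H" "f t \<noteq> g t" "\<And>s. f s \<noteq> g s \<Longrightarrow> s \<in> below t"
proof -
  have "f \<noteq> cap"
    using assms not_face_cap face_supp by metis
  then obtain p q where pq: "supp f \<subseteq> {p, q}" "p = q \<or> p \<prec> q"
    using assms(1) face_supp unfolding face_def by blast
  have diff: "s \<in> H \<and> (s = p \<or> s = q)" if "f s \<noteq> g s" for s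
  proof -
    have "f s \<noteq> 0 \<and> g s \<noteq> 0"
      using that assms(3) by (auto simp: supp_def set_eq_iff)
    then have "s \<in> supp f" "cap s \<noteq> 1" "cap s \<noteq> 0"
      using level_le_cap[OF assms(1), of s] level_le_cap[OF assms(2), of s] that
      by (auto simp: supp_def)
    then show ?thesis using pq(1) by (auto simp: cap_def split: if_splits)
  qed
  obtain x where "f x \<noteq> g x" using assms(4) by auto
  show thesis
  proof (cases "f q \<noteq> g q")
    case True
    then show thesis using diff pq(2) by (intro that[of q]) (auto simp: below_def)
  next
    case False
    then have "f p \<noteq> g p" using \<open>f x \<noteq> g x\<close> diff by blast
    then show thesis using diff False by (intro that[of p]) (auto simp: below_def)
  qed
qed

lemma levels_at_difference:
  assumes "f \<in> level_funs" "g \<in> level_funs" "supp f = supp g" "f t < g t"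
  shows "f t = 1" "g t = 2"
proof -
  have "f t \<noteq> 0" using assms(3,4) by (auto simp: supp_def set_eq_iff)
  then show "f t = 1" "g t = 2" using assms(4) level_le_2[OF assms(2), of t] by auto
qed

text \<open>
  It suffices to treat related functions \<open>f \<le> g\<close>, as two related functions are both related to
  their meet. If \<open>m\<close> is the greatest place where \<open>f\<close> and \<open>g\<close> differ, then
  \<open>f \<squnion> a\<^sub>m = f\<close> and \<open>f \<squnion> b\<^sub>m = g\<close>, since raising \<open>m\<close> to level \<open>2\<close> raises all smaller
  places of the support. So the single pair \<open>a\<^sub>m \<equiv> b\<^sub>m\<close> yields \<open>f \<equiv> g\<close>.
\<close>

lemma collapse_below_least:
  assumes r: "lattice_congruence L r" and t: "t \<in> H" "(point t 1, point t 2) \<in> r"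
  shows "collapse (below t) \<subseteq> r"
proof -
  have cell: "(point s 1, point s 2) \<in> r" if "s \<in> below t" for s
    using that t cong_cell_below[OF r t(2)] by (auto simp: below_def)
  have up: "(f, g) \<in> r" if fg: "(f, g) \<in> collapse (below t)" and le: "f \<le> g" for f g
  proof (cases "f = g")
    case False
    have c: "f \<in> level_funs" "g \<in> level_funs" "supp f = supp g" "\<And>s. f s \<noteq> g s \<Longrightarrow> s \<in> below t"
      using fg by (auto simp: collapse_def)
    obtain m where m: "m \<in> H" "f m \<noteq> g m" "\<And>s. f s \<noteq> g s \<Longrightarrow> s \<in> below m"
      using greatest_difference[OF c(1-3) False] by blast
    have "f m < g m" using m(2) le by (simp add: le_fun_def order_less_le)
    note lev = levels_at_difference[OF c(1-3) this]
    have pc: "point m 1 \<in> level_funs" "point m 2 \<in> level_funs"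
      using m(1) by (auto intro!: point_in simp: cap_def)
    have "vee f (point m 1) = f"
      using c pc lev by (intro antisym vee_least vee_upper) (auto simp: le_fun_def point_def)
    moreover have "vee f (point m 2) = g"
    proof (rule antisym)
      show "vee f (point m 2) \<le> g"
        using c pc lev le by (intro vee_least) (auto simp: le_fun_def point_def)
      let ?j = "vee f (point m 2)"
      have j: "?j \<in> level_funs" "f \<le> ?j" "point m 2 \<le> ?j"
        using c pc by (auto intro: vee_in vee_upper)
      have jm: "?j m = 2"
        using j(3) level_le_2[OF j(1), of m] by (auto simp: le_fun_def point_def dest: spec[of _ m])
      \<comment> \<open>Every other place of difference lies below \<open>m\<close>, so closedness of the join lifts it.\<close>
      show "g \<le> ?j"
      proof (rule le_funI)
        fix s
        show "g s \<le> ?j s"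
        proof (cases "f s = g s")
          case True
          then show ?thesis using j(2) by (metis le_funD)
        next
          case False
          then have "f s < g s" using le by (simp add: le_fun_def order_less_le)
          then have "f s = 1" using levels_at_difference[OF c(1-3)] by blast
          then have "?j s \<noteq> 0" using j(2) by (metis le_funD le_zero_eq one_neq_zero)
          then have "?j s = 2"
            using m(3)[OF False] closedD[OF j(1)] jm by (auto simp: below_def)
          then show ?thesis using level_le_2[OF c(2)] by simp
        qed
      qed
    qed
    ultimately show ?thesis
      using cong_vee[OF r cong_refl[OF r c(1)] cell[OF c(4)[OF m(2)]]] by simp
  qed (use fg in \<open>auto simp: collapse_def cong_refl[OF r]\<close>)
  show ?thesis
  proof (rule subrelI)
    fix f g assume fg: "(f, g) \<in> collapse (below t)"
    have "(inf f g, f) \<in> r"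
      using collapse_inf[OF fg, of g g] fg
      by (intro up) (auto simp: collapse_def supp_inf inf_in inf_nat_def min_def)
    moreover have "(inf f g, g) \<in> r"
      using collapse_inf[OF fg, of g g] fg
      by (intro up) (auto simp: collapse_def supp_inf inf_in inf_nat_def min_def)
    ultimately show "(f, g) \<in> r" using cong_trans[OF r] cong_sym[OF r] by blast
  qed
qed

lemma con_diff_supp:
  assumes "f \<in> level_funs" "g \<in> level_funs" "supp f \<noteq> supp g"
  shows "con L f g = level_funs \<times> level_funs"
  using supp_split_total[of "con L f g" f g] con_congruence[OF lattice_L, of f g] assms by simp

lemma con_same:
  assumes "f \<in> level_funs" shows "con L f f = collapse {}"
proof (rule con_eqI)
  show "lattice_congruence L (collapse {})" by (rule collapse_congruence) simp
  show "(f, f) \<in> collapse {}" using assms by (simp add: collapse_def)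
  fix r assume r: "lattice_congruence L r"
  show "collapse {} \<subseteq> r"
  proof (rule subrelI)
    fix f g assume "(f, g) \<in> collapse {}"
    then have "f \<in> level_funs" "f = g" by (auto simp: collapse_def)
    then show "(f, g) \<in> r" using cong_refl[OF r] by simp
  qed
qed

text \<open>
  Meeting \<open>f\<close> and \<open>g\<close> with \<open>b\<^sub>t\<close>, for the greatest place \<open>t\<close> of difference, gives \<open>a\<^sub>t\<close> and
  \<open>b\<^sub>t\<close> in some order. So \<open>f \<equiv> g\<close> forces \<open>a\<^sub>t \<equiv> b\<^sub>t\<close>, and the latter in turn forces \<open>f \<equiv> g\<close>.
\<close>

lemma con_same_supp:
  assumes c: "f \<in> level_funs" "g \<in> level_funs" "supp f = supp g" and ne: "f \<noteq> g"
  obtains t where "t \<in> H" "con L f g = collapse (below t)"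
proof -
  obtain t where t: "t \<in> H" "f t \<noteq> g t" "\<And>s. f s \<noteq> g s \<Longrightarrow> s \<in> below t"
    using greatest_difference[OF c ne] by blast
  have pc: "point t 2 \<in> level_funs" using t(1) by (auto intro!: point_in simp: cap_def)
  have "con L f g = collapse (below t)"
  proof (rule con_eqI[OF collapse_congruence[OF below_down]])
    show "(f, g) \<in> collapse (below t)" using c t by (simp add: collapse_def)
    fix s assume s: "lattice_congruence L s" "(f, g) \<in> s"
    have *: "(point t 1, point t 2) \<in> s"
      if "(f, g) \<in> s" "f t < g t" "f \<in> level_funs" "g \<in> level_funs" "supp f = supp g" for f g
    proof -
      note lev = levels_at_difference[OF that(3-5,2)]
      have "inf f (point t 2) = point t 1" "inf g (point t 2) = point t 2"
        using lev by (auto simp: point_def fun_eq_iff inf_nat_def)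
      then show ?thesis using cong_inf[OF s(1) that(1) cong_refl[OF s(1) pc]] by simp
    qed
    have "(point t 1, point t 2) \<in> s"
      using *[of f g] *[of g f] s t(2) c cong_sym[OF s(1)] by (metis nat_neq_iff)
    then show "collapse (below t) \<subseteq> s" by (rule collapse_below_least[OF s(1) t(1)])
  qed
  then show thesis using t(1) that by blast
qed

lemma cell_in_collapse: "t \<in> H \<Longrightarrow> (point t 1, point t 2) \<in> collapse D \<longleftrightarrow> t \<in> D"
proof -
  assume t: "t \<in> H"
  then have "point t 1 \<in> level_funs" "point t 2 \<in> level_funs" by (auto intro!: point_in simp: cap_def)
  then show ?thesis by (auto simp: collapse_def supp_def point_def)
qed

lemma con_cell: "t \<in> H \<Longrightarrow> con L (point t 1) (point t 2) = collapse (below t)"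
  using collapse_below_least cell_in_collapse[of t "below t"]
  by (intro con_eqI collapse_congruence[OF below_down]) (auto simp: below_def)

lemma collapse_proper: "collapse D \<noteq> level_funs \<times> level_funs"
proof -
  have "(\<lambda>_. 0, cap) \<notin> collapse D"
    using supp_bot_cap by (simp add: collapse_def)
  then show ?thesis using bot_in cap_in by auto
qed

lemma carrier_Princ_L:
  "carrier (Princ L) = {level_funs \<times> level_funs, collapse {}} \<union> (\<lambda>t. collapse (below t)) ` H"
proof (intro equalityI subsetI)
  fix c assume "c \<in> carrier (Princ L)"
  then obtain f g where fg: "f \<in> level_funs" "g \<in> level_funs" and c: "c = con L f g"
    by (auto simp: carrier_Princ)
  consider "f = g" | "f \<noteq> g" "supp f = supp g" | "supp f \<noteq> supp g" by blast
  then show "c \<in> {level_funs \<times> level_funs, collapse {}} \<union> (\<lambda>t. collapse (below t)) ` H"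
  proof cases
    case 1
    then show ?thesis using con_same fg c by simp
  next
    case 2
    then obtain t where "t \<in> H" "con L f g = collapse (below t)"
      using fg by (elim con_same_supp[rotated -1])
    then show ?thesis using c by simp
  next
    case 3
    then show ?thesis using con_diff_supp fg c by simp
  qed
next
  have princ: "con L f g \<in> carrier (Princ L)" if "f \<in> level_funs" "g \<in> level_funs" for f g
    using that by (auto simp: carrier_Princ)
  fix c assume "c \<in> {level_funs \<times> level_funs, collapse {}} \<union> (\<lambda>t. collapse (below t)) ` H"
  then consider "c = level_funs \<times> level_funs" | "c = collapse {}" | t where "t \<in> H" "c = collapse (below t)"
    by auto
  then show "c \<in> carrier (Princ L)"
  proof cases
    case 1
    then show ?thesis using con_diff_supp[OF bot_in cap_in supp_bot_cap] princ[OF bot_in cap_in] by simp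
  next
    case 2
    then show ?thesis using con_same[OF bot_in] princ[OF bot_in bot_in] by simp
  next
    case 3
    then have "point t 1 \<in> level_funs" "point t 2 \<in> level_funs" by (auto intro!: point_in simp: cap_def)
    then show ?thesis using 3 con_cell[of t] princ[of "point t 1" "point t 2"] by simp
  qed
qed

end

section \<open>Bounded orders as principal congruences\<close>

locale bounded_order = partial_order P for P :: "'a gorder" (structure) +
  fixes zero one :: 'a
  assumes zero: "least P zero (carrier P)"
    and one: "greatest P one (carrier P)"
    and zero_neq_one: "zero \<noteq> one"
begin

definition inner :: "'a set" where
  "inner = carrier P - {zero, one}"

definition prec :: "'a + nat \<Rightarrow> 'a + nat \<Rightarrow> bool" where
  "prec x y \<longleftrightarrow> (\<exists>p\<in>inner. \<exists>q\<in>inner. x = Inl p \<and> y = Inl q \<and> p \<sqsubseteq> q \<and> p \<noteq> q)"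

sublocale level_frame "Inl ` inner" "Inr ` {..<3::nat}" prec
proof
  show "prec p r" if "prec p q" "prec q r" for p q r
    using that by (auto simp: prec_def inner_def intro: le_trans dest: le_antisym)
  show "\<exists>u\<in>Inr ` {..<3::nat}. \<exists>v\<in>Inr ` {..<3}. u \<noteq> v \<and> u \<noteq> j \<and> v \<noteq> j" for j :: "'a + nat"
  proof -
    consider "j = Inr 0" | "j = Inr 1" | "j \<noteq> Inr 0" "j \<noteq> Inr 1" by blast
    then show ?thesis
    proof cases
      case 1 then show ?thesis by (intro bexI[of _ "Inr 1"] bexI[of _ "Inr 2"]) auto
    next
      case 2 then show ?thesis by (intro bexI[of _ "Inr 0"] bexI[of _ "Inr 2"]) auto
    next
      case 3 then show ?thesis by (intro bexI[of _ "Inr 0"] bexI[of _ "Inr 1"]) auto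
    qed
  qed
qed (auto simp: prec_def)

text \<open>
  For \<open>t = zero\<close> the set of collapsed indices is empty and the congruence is the identity. The
  case \<open>t = one\<close> has to be separate: collapsing all inner indices still leaves the supports
  apart, so the formula would not give the total relation.
\<close>

definition assigned :: "'a \<Rightarrow> (('a + nat \<Rightarrow> nat) \<times> ('a + nat \<Rightarrow> nat)) set" where
  "assigned t = (if t = one then level_funs \<times> level_funs else collapse {Inl s | s. s \<in> inner \<and> s \<sqsubseteq> t})"

lemma zero_in: "zero \<in> carrier P" and zero_le: "x \<in> carrier P \<Longrightarrow> zero \<sqsubseteq> x"
  using zero by (auto simp: least_def)

lemma one_in: "one \<in> carrier P" and le_one: "x \<in> carrier P \<Longrightarrow> x \<sqsubseteq> one"
  using one by (auto simp: greatest_def)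

lemma assigned_one: "assigned one = level_funs \<times> level_funs"
  by (simp add: assigned_def)

lemma assigned_zero: "assigned zero = collapse {}"
proof -
  have none: "{Inl s | s. s \<in> inner \<and> s \<sqsubseteq> zero} = ({} :: ('a + nat) set)"
    using zero_le zero_in le_antisym by (auto simp: inner_def)
  show ?thesis unfolding assigned_def none using zero_neq_one by simp
qed

lemma assigned_inner:
  assumes "t \<in> inner" shows "assigned t = collapse (below (Inl t))"
proof -
  have "{Inl s | s. s \<in> inner \<and> s \<sqsubseteq> t} = below (Inl t)"
    using assms by (auto simp: below_def prec_def inner_def)
  then show ?thesis using assms by (auto simp: assigned_def inner_def)
qed

lemma assigned_le_iff:
  assumes "s \<in> carrier P" "t \<in> carrier P"
  shows "assigned s \<subseteq> assigned t \<longleftrightarrow> s \<sqsubseteq> t"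
proof
  assume le: "s \<sqsubseteq> t"
  show "assigned s \<subseteq> assigned t"
  proof (cases "t = one")
    case True
    then show ?thesis by (auto simp: assigned_def collapse_def)
  next
    case False
    then have "s \<noteq> one" using le assms le_one le_antisym one_in by metis
    moreover have "u \<sqsubseteq> t" if "u \<in> inner" "u \<sqsubseteq> s" for u
      using that le assms le_trans by (auto simp: inner_def)
    ultimately show ?thesis using False by (auto simp: assigned_def collapse_def)
  qed
next
  assume sub: "assigned s \<subseteq> assigned t"
  consider "s = zero" | "t = one" | "s = one" "t \<noteq> one" | "s \<in> inner" "t \<noteq> one"
    using assms by (auto simp: inner_def)
  then show "s \<sqsubseteq> t"
  proof cases
    case 3
    have "assigned t \<subseteq> level_funs \<times> level_funs" using 3 by (auto simp: assigned_def collapse_def)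
    then have "assigned t = level_funs \<times> level_funs" using sub 3 by (simp add: assigned_one)
    then show ?thesis using 3 collapse_proper by (simp add: assigned_def)
  next
    case 4
    then have "(point (Inl s) 1, point (Inl s) 2) \<in> assigned s"
      by (simp add: assigned_inner cell_in_collapse below_def del: One_nat_def)
    then have "(point (Inl s) 1, point (Inl s) 2) \<in> assigned t"
      using sub by blast
    then show ?thesis using 4 by (auto simp: assigned_def cell_in_collapse simp del: One_nat_def)
  qed (use assms zero_le le_one in auto)
qed

lemma order_isomorphic_Princ_L: "order_isomorphic P (Princ L)"
proof -
  have split: "carrier P = insert one (insert zero inner)"
    using zero_in one_in by (auto simp: inner_def)
  have "assigned ` carrier P = carrier (Princ L)"
    unfolding split carrier_Princ_L by (simp add: assigned_one assigned_zero assigned_inner image_image)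
  moreover have "inj_on assigned (carrier P)"
    using assigned_le_iff by (intro inj_onI) (metis le_antisym order_refl)
  moreover have "order_emb P (Princ L) assigned"
    unfolding order_emb_def
    using assigned_le_iff partial_order.axioms(1)[OF partial_order_Princ] weak_partial_order_axioms
    by (simp add: le_Princ)
  ultimately show ?thesis
    unfolding order_isomorphic_def bij_betw_def by blast
qed

text \<open>
  The code \<open>0\<close> stands for the top and the codes \<open>1, 2, 3\<close> for the atoms at \<open>Inr 0, Inr 1, Inr 2\<close>.
  From \<open>4\<close> on, the two ternary digits of \<open>n - 4\<close> are the levels at \<open>Inl p\<close> and \<open>Inl q\<close>; with
  \<open>p = q\<close> this also covers supports with fewer than two indices.
\<close>

definition decode :: "nat \<times> 'a \<times> 'a \<Rightarrow> 'a + nat \<Rightarrow> nat" where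
  "decode = (\<lambda>(n, p, q).
     if n = 0 then cap
     else if n \<le> 3 then point (Inr (n - 1)) 1
     else (\<lambda>j. if j = Inl p then (n - 4) div 3 else if j = Inl q then (n - 4) mod 3 else 0))"

text \<open>
  The bound on the codes makes the lattice finite whenever \<open>P\<close> is.
\<close>

lemma level_funs_decode: "level_funs \<subseteq> decode ` ({..<13} \<times> carrier P \<times> carrier P)"
proof
  fix f assume f: "f \<in> level_funs"
  have two: "f \<in> decode ` ({..<13} \<times> carrier P \<times> carrier P)"
    if s: "supp f \<subseteq> {Inl p, Inl q}" and pq: "p \<in> carrier P" "q \<in> carrier P" for p q
  proof (rule image_eqI)
    show "f = decode (4 + 3 * f (Inl p) + f (Inl q), p, q)"
      using s level_le_2[OF f, of "Inl q"] by (auto simp: decode_def fun_eq_iff supp_def)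
    show "(4 + 3 * f (Inl p) + f (Inl q), p, q) \<in> {..<13} \<times> carrier P \<times> carrier P"
      using pq level_le_2[OF f, of "Inl p"] level_le_2[OF f, of "Inl q"] by auto
  qed
  show "f \<in> decode ` ({..<13} \<times> carrier P \<times> carrier P)"
  proof (cases "f = cap")
    case True
    then have "f = decode (0, zero, zero)" by (simp add: decode_def)
    then show ?thesis by (rule image_eqI) (simp add: zero_in)
  next
    case False
    then obtain x y where xy: "supp f \<subseteq> {x, y}" "x = y \<or> prec x y"
      using face_supp[OF f] unfolding face_def by blast
    show ?thesis
    proof (cases "\<exists>k<3. f (Inr k) \<noteq> 0")
      case True
      then obtain k where k: "k < 3" "f (Inr k) \<noteq> 0" by blast
      have "f j = point (Inr k) 1 j" for j
      proof (cases "j = Inr k")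
        case True
        then show ?thesis
          using level_le_cap[OF f, of "Inr k"] k by (auto simp: cap_def point_def split: if_splits)
      next
        case False
        have "Inr k \<in> supp f" using k by (simp add: supp_def)
        then have "supp f \<subseteq> {Inr k}" using xy by (auto simp: prec_def)
        then show ?thesis using False by (auto simp: supp_def point_def)
      qed
      then have "f = decode (Suc k, zero, zero)"
        using k(1) by (simp add: decode_def fun_eq_iff)
      then show ?thesis by (rule image_eqI) (use k zero_in in simp)
    next
      case False
      have in_inner: "j \<in> Inl ` inner" if "j \<in> supp f" for j
        using that False level_le_cap[OF f, of j] by (auto simp: supp_def cap_def split: if_splits)
      show ?thesis
      proof (cases "supp f = {}")
        case True
        then show ?thesis using zero_in by (intro two[of zero zero]) auto
      next
        case False
        then have "x \<in> Inl ` inner" "y \<in> Inl ` inner"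
          using xy in_inner prec_mem by blast+
        then show ?thesis using xy(1) two by (auto simp: inner_def)
      qed
    qed
  qed
qed

end

lemma one_element_lattice:
  fixes P :: "'a gorder" and c :: 'c
  assumes "partial_order P" "carrier P = {z}"
  obtains K :: "'c gorder"
  where "bounded_lattice K" "order_isomorphic P (Princ K)" "carrier K = {c}"
proof -
  interpret P: partial_order P by fact
  define K :: "'c gorder" where "K = \<lparr>carrier = {c}, eq = (=), le = (\<lambda>_ _. True)\<rparr>"
  have K: "bounded_lattice K"
    by unfold_locales (auto simp: K_def least_def greatest_def Upper_def Lower_def)
  have "carrier (Princ K) = {con K c c}"
    by (auto simp: carrier_Princ K_def)
  then have "bij_betw (\<lambda>_. con K c c) (carrier P) (carrier (Princ K))"
    using assms(2) by (simp add: bij_betw_def)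
  moreover have "order_emb P (Princ K) (\<lambda>_. con K c c)"
    unfolding order_emb_def
    using assms(2) P.le_refl partial_order.axioms(1)[OF partial_order_Princ]
      P.weak_partial_order_axioms
    by (simp add: le_Princ)
  ultimately have "order_isomorphic P (Princ K)"
    unfolding order_isomorphic_def by blast
  then show thesis using K by (intro that[of K]) (simp_all add: K_def)
qed

theorem theorem1:
  fixes P :: "'a gorder" and zero one :: 'a
  assumes "partial_order P"
    and "least P zero (carrier P)"
    and "greatest P one (carrier P)"
  shows "\<exists>K :: (nat \<times> 'a \<times> 'a) gorder.
    bounded_lattice K \<and> order_isomorphic P (Princ K) \<and>
    (finite (carrier P) \<longrightarrow> finite (carrier K))"
proof (cases "zero = one")
  case True
  interpret partial_order P by fact
  have "carrier P = {zero}"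
    using assms(2,3) True by (auto simp: least_def greatest_def)
  then obtain K :: "(nat \<times> 'a \<times> 'a) gorder"
    where "bounded_lattice K" "order_isomorphic P (Princ K)" "carrier K = {(0, zero, zero)}"
    by (rule one_element_lattice[OF assms(1)])
  then show ?thesis by (intro exI[of _ K]) simp
next
  case False
  interpret bounded_order P zero one
    using assms False by (simp add: bounded_order_def bounded_order_axioms_def)
  let ?C = "{..<13} \<times> carrier P \<times> carrier P"
  have "inj_on (inv_into ?C decode) (carrier L)"
    using level_funs_decode by (simp add: inj_on_inv_into)
  then obtain K :: "(nat \<times> 'a \<times> 'a) gorder"
    where K: "bounded_lattice K" "carrier K = inv_into ?C decode ` carrier L"
      "lattice_iso L K (inv_into ?C decode)"
    by (rule bounded_lattice_on_image[OF bounded_lattice_L])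
  have "order_isomorphic P (Princ K)"
    by (rule lattice_iso.Princ_iso[OF K(3) order_isomorphic_Princ_L])
  moreover have "finite (carrier K)" if "finite (carrier P)"
    unfolding K(2) carrier_L
    using that by (intro finite_imageI finite_subset[OF level_funs_decode]) simp
  ultimately show ?thesis using K(1) by blast
qed

end
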